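(* If $n$ is a positive integer, then $$\mathcal{P}(S_n) = \frac{1}{2}+\frac{1}{2n^2}\cdot\mathbf{1}_{n\text{ is odd}},$$ where $S_n$ is the star graph on $n$ vertices and $\mathcal{P}(T)$ is the probability that the first player wins the tree search game on $T$ when both players play uniformly at random.
   Context: A tree is a connected acyclic undirected graph with a finite, positive number of vertices; $|T|$ is the number of vertices of $T$; $T\smallsetminus v$ is the forest obtained by deleting $v$ and its incident edges. $S_n$ is the star graph on $n$ vertices (a center adjacent to $n-1$ leaves; $S_1$ is a single vertex and $S_2$ a single edge). Tree search game on $T$: one vertex of $T$ is selected uniformly at random as the target, unknown to both players. The players alternately guess vertices. If the guess $v$ is the target, the player who made it wins. Otherwise both players are informed which component of $T\smallsetminus v$ contains the target, and the game continues on that component with the other player to move. $\mathcal{P}(T)$ is the probability that the first player wins on $T$ when both players always choose a vertex uniformly at random from among the vertices that could still be the target. Equivalently, with $n=|T|$, it is determined recursively by $$\mathcal{P}(T)=1-\frac1{n^2}\sum_{v\in V(T)}\sum_{T'}|T'|\,\mathcal{P}(T'),$$ where $T'$ ranges over the components of $T\smallsetminus v$ (empty sums are $0$). $\mathbf{1}_A$ is $1$ if the condition $A$ holds and $0$ otherwise. *)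

theory Defs
  imports "HOL-Probability.Probability" "Graph_Theory.Digraph_Component"
begin

hide_const (open) Topological_Spaces.connected

text \<open>
  Undirected graphs are symmetric loop-free digraphs without parallel arcs (locale \<^locale>\<open>graph\<close>).
  The library's notions of forest and tree forbid all directed cycles and hence do not
  apply to symmetric digraphs, where the two arcs of an edge form a directed cycle of
  length 2. The cycles of the undirected graph are the directed cycles of length at least 3.
\<close>

definition undirected_tree :: "('a, 'b) pre_digraph \<Rightarrow> bool" where
  "undirected_tree G \<longleftrightarrow>
     graph G \<and> connected G \<and> \<not> (\<exists>p. pre_digraph.cycle G p \<and> length p \<ge> 3)"

definition star_graph :: "nat \<Rightarrow> (nat, nat \<times> nat) pre_digraph" where
  "star_graph n = with_proj
     \<lparr> pverts = {0..<n}, parcs = (\<Union>i\<in>{1..<n}. {(0, i), (i, 0)}) \<rparr>"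

text \<open>In a symmetric digraph, strongly connected components are connected components.\<close>

definition component_of :: "('a, 'b) pre_digraph \<Rightarrow> 'a \<Rightarrow> ('a, 'b) pre_digraph" where
  "component_of G t = G \<restriction> pre_digraph.scc_of G t"

lemma verts_component_of_subset: "verts (component_of G t) \<subseteq> verts G"
  by (auto simp: component_of_def pre_digraph.scc_of_def elim: reachable_in_vertsE)

text \<open>
  \<open>random_play G t\<close> is the outcome of the game on \<open>G\<close> with target \<open>t\<close> when both players guess
  uniformly at random among the vertices that can still be the target, i.e. among the vertices
  of the current component. The outcome \<^const>\<open>True\<close> means that the player who is about to move
  wins; as the roles swap after a wrong guess, the outcome of the remaining game is negated.
  The value for a target outside \<open>G\<close> or for an infinite \<open>G\<close> is irrelevant.
\<close>

function random_play :: "('a, 'b) pre_digraph \<Rightarrow> 'a \<Rightarrow> bool pmf" where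
  "random_play G t =
     (if finite (verts G) \<and> t \<in> verts G
      then pmf_of_set (verts G) \<bind> (\<lambda>v.
             if v = t then return_pmf True
             else map_pmf Not (random_play (component_of (pre_digraph.del_vert G v) t) t))
      else return_pmf False)"
  by auto
termination
proof (relation "Wellfounded.measure (\<lambda>(G, t). card (verts G))", goal_cases)
  case (2 G t v)
  then have v: "v \<in> verts G"
    by (subst (asm) set_pmf_of_set) auto
  have "verts (component_of (pre_digraph.del_vert G v) t) \<subseteq> verts G - {v}"
    using verts_component_of_subset by (metis pre_digraph.verts_del_vert)
  with v 2 have "verts (component_of (pre_digraph.del_vert G v) t) \<subset> verts G"
    by blast
  with 2 show ?case
    by (simp add: psubset_card_mono)
qed simp

declare random_play.simps [simp del]

definition first_player_win_prob :: "('a, 'b) pre_digraph \<Rightarrow> real" where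
  "first_player_win_prob G =
     measure_pmf.prob (pmf_of_set (verts G) \<bind> random_play G) {True}"

lemma undirected_tree_star_graph:
  assumes "n > 0"
  shows "undirected_tree (star_graph n)"
proof -
  let ?S = "star_graph n"
  have V: "verts ?S = {0..<n}" and A: "arcs ?S = (\<Union>i\<in>{1..<n}. {(0, i), (i, 0)})"
    and T: "tail ?S = fst" and H: "head ?S = snd"
    by (simp_all add: star_graph_def with_proj_def)
  have ends: "arcs_ends ?S = arcs ?S"
    by (simp add: arcs_ends_def arc_to_ends_def T H)
  have fin: "finite (arcs ?S)"
    by (simp add: A)
  interpret S: wf_digraph ?S
    by unfold_locales (auto simp: V A T H)
  interpret S: graph ?S
    by unfold_locales
      (auto simp: V A T H arc_to_ends_def symmetric_def ends sym_def fin[unfolded A])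
  have "connected ?S"
    unfolding connected_conv
  proof (intro conjI ballI)
    show "verts ?S \<noteq> {}"
      using assms by (simp add: V)
  next
    fix u v assume u: "u \<in> verts ?S" and v: "v \<in> verts ?S"
    have adj: "(w, 0) \<in> (arcs_ends ?S)\<^sup>s \<and> (0, w) \<in> (arcs_ends ?S)\<^sup>s"
      if "w \<in> verts ?S" "w \<noteq> 0" for w
      using that by (auto simp: ends A V symcl_def)
    have z: "0 \<in> verts ?S"
      using assms by (simp add: V)
    have "(w, 0) \<in> rtrancl_on (verts ?S) ((arcs_ends ?S)\<^sup>s)"
      if "w \<in> verts ?S" for w
      using that adj[of w] z
      by (cases "w = 0")
        (auto intro: rtrancl_on_refl converse_rtrancl_on_into_rtrancl_on)
    moreover have "(0, w) \<in> rtrancl_on (verts ?S) ((arcs_ends ?S)\<^sup>s)"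
      if "w \<in> verts ?S" for w
      using that adj[of w] z
      by (cases "w = 0")
        (auto intro: rtrancl_on_refl converse_rtrancl_on_into_rtrancl_on)
    ultimately show "(u, v) \<in> rtrancl_on (verts ?S) ((arcs_ends ?S)\<^sup>s)"
      using u v by (meson rtrancl_on_trans)
  qed
  moreover have False if p: "S.cycle p" and len: "length p \<ge> 3" for p
  proof -
    obtain u where w: "S.awalk u p u" and d: "distinct (tl (S.awalk_verts u p))"
      using p by (auto simp: S.cycle_def)
    obtain e1 e2 e3 q where pq: "p = e1 # e2 # e3 # q"
      using len by (auto simp: Suc_le_length_iff numeral_3_eq_3)
    have e: "e1 \<in> arcs ?S" "e2 \<in> arcs ?S" "e3 \<in> arcs ?S"
      "fst e1 = u" "fst e2 = snd e1" "fst e3 = snd e2"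
      using w by (auto simp: S.awalk_def pq T H)
    have tl: "tl (S.awalk_verts u p) = fst e2 # fst e3 # S.awalk_verts (snd e3) q"
      by (simp add: pq T H)
    define vs where "vs = S.awalk_verts (snd e3) q"
    have "S.awalk (snd e3) q u"
      using w by (auto simp: pq S.awalk_Cons_iff T H)
    then have vs: "hd vs = snd e3" "last vs = u" "vs \<noteq> []"
      by (auto simp only: vs_def S.awalk_conv S.awalk_verts_non_Nil)
    have u_in: "u \<in> set vs"
      using vs by (metis last_in_set)
    have s3: "snd e3 \<in> set vs"
      using vs by (metis hd_in_set)
    have d': "fst e2 \<notin> set vs" "fst e3 \<notin> set vs" "fst e2 \<noteq> fst e3"
      using d by (auto simp: tl vs_def)
    show False
      using e d' u_in s3 by (auto simp: A)
  qed
  ultimately show ?thesis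
    using S.graph_axioms by (auto simp: undirected_tree_def)
qed

lemma sum_over_sccs:
  fixes f :: "('a, 'b) pre_digraph \<Rightarrow> 'a \<Rightarrow> real"
  assumes "fin_digraph G"
  shows "(\<Sum>t\<in>verts G. f (component_of G t) t) = (\<Sum>T\<in>pre_digraph.sccs G. \<Sum>t\<in>verts T. f T t)"
proof -
  interpret fin_digraph G by fact
  have sccs: "sccs = component_of G ` verts G"
    unfolding sccs_conv_sccs_verts sccs_verts_conv_scc_of image_image component_of_def ..
  have mem: "verts T = {t \<in> verts G. component_of G t = T}" if T: "T \<in> sccs" for T
  proof -
    obtain s where s: "s \<in> verts G" "T = component_of G s"
      using T unfolding sccs by blast
    have "component_of G t = T \<longleftrightarrow> t \<in> scc_of s" if "t \<in> verts G" for t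
      using scc_of_eq[of t s] in_scc_of_self[OF that] s(2)
      by (metis component_of_def induce_subgraph_verts)
    moreover have "scc_of s \<subseteq> verts G"
      by (metis component_of_def induce_subgraph_verts verts_component_of_subset)
    ultimately show ?thesis
      unfolding s(2) by (auto simp: component_of_def)
  qed
  have "(\<Sum>t\<in>verts G. f (component_of G t) t) =
      (\<Sum>T\<in>component_of G ` verts G. \<Sum>t | t \<in> verts G \<and> component_of G t = T. f (component_of G t) t)"
    by (rule sum.image_gen) simp
  also have "\<dots> = (\<Sum>T\<in>sccs. \<Sum>t\<in>verts T. f T t)"
    unfolding sccs[symmetric] by (intro sum.cong) (auto simp: mem)
  finally show ?thesis .
qed

lemma first_player_win_prob_eq_sum:
  assumes "finite (verts G)" and "verts G \<noteq> {}"
  shows "real (card (verts G)) * first_player_win_prob G =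
    (\<Sum>t\<in>verts G. pmf (random_play G t) True)"
  using assms
  by (simp add: first_player_win_prob_def measure_pmf_single pmf_bind_pmf_of_set)

lemma pmf_random_play:
  assumes "finite (verts G)" and "t \<in> verts G"
  shows "real (card (verts G)) * pmf (random_play G t) True =
    (\<Sum>v\<in>verts G. if v = t then 1
       else 1 - pmf (random_play (component_of (pre_digraph.del_vert G v) t) t) True)"
proof -
  have neg: "pmf (map_pmf Not p) True = 1 - pmf p True" for p
  proof -
    have "pmf (map_pmf Not p) True = pmf p False"
      using pmf_map_inj'[of Not p False] by (simp add: inj_def)
    also have "\<dots> = 1 - pmf p True"
      by (simp add: pmf_False_conv_True)
    finally show ?thesis .
  qed
  have "verts G \<noteq> {}"
    using assms by auto
  then show ?thesis
    using assms
    by (subst random_play.simps)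
       (auto simp: pmf_bind_pmf_of_set neg intro!: sum.cong split: if_splits)
qed

text \<open>The recursion that characterises the winning probability.\<close>

lemma first_player_win_prob_rec:
  assumes "graph G" and "verts G \<noteq> {}"
  shows "first_player_win_prob G =
    1 - 1 / (real (card (verts G)))\<^sup>2 *
      (\<Sum>v\<in>verts G. \<Sum>T\<in>pre_digraph.sccs (pre_digraph.del_vert G v).
         real (card (verts T)) * first_player_win_prob T)"
proof -
  interpret graph G by fact
  let ?n = "real (card (verts G))"
  let ?q = "\<lambda>T t. pmf (random_play T t) True"
  let ?C = "\<lambda>v t. component_of (del_vert v) t"
  have n: "?n > 0"
    using assms(2) by (simp add: card_gt_0_iff)
  have inner: "(\<Sum>t\<in>verts G. if v = t then 0 else ?q (?C v t) t) =
      (\<Sum>T\<in>pre_digraph.sccs (del_vert v). real (card (verts T)) * first_player_win_prob T)"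
    if v: "v \<in> verts G" for v
  proof -
    interpret D: fin_digraph "del_vert v"
      by (rule fin_digraph_del_vert)
    have "(\<Sum>t\<in>verts G. if v = t then 0 else ?q (?C v t) t) =
        (\<Sum>t\<in>verts (del_vert v). ?q (?C v t) t)"
      by (rule sum.mono_neutral_cong_right) (auto simp: pre_digraph.verts_del_vert)
    also have "\<dots> = (\<Sum>T\<in>D.sccs. \<Sum>t\<in>verts T. ?q T t)"
      by (rule sum_over_sccs) (rule D.fin_digraph)
    also have "\<dots> = (\<Sum>T\<in>D.sccs. real (card (verts T)) * first_player_win_prob T)"
    proof (rule sum.cong[OF refl])
      fix T assume "T \<in> D.sccs"
      then have "verts T \<subseteq> verts (del_vert v)" "verts T \<noteq> {}"
        by (auto simp: D.sccs_def strongly_connected_def)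
      then show "(\<Sum>t\<in>verts T. ?q T t) = real (card (verts T)) * first_player_win_prob T"
        using first_player_win_prob_eq_sum[of T] D.finite_verts finite_subset by metis
    qed
    finally show ?thesis .
  qed
  have "?n\<^sup>2 * first_player_win_prob G = (\<Sum>t\<in>verts G. ?n * ?q G t)"
    using first_player_win_prob_eq_sum[of G] assms(2)
    by (simp add: power2_eq_square sum_distrib_left mult.assoc)
  also have "\<dots> = (\<Sum>t\<in>verts G. \<Sum>v\<in>verts G. 1 - (if v = t then 0 else ?q (?C v t) t))"
    by (intro sum.cong refl) (auto simp: pmf_random_play intro!: sum.cong)
  also have "\<dots> = ?n\<^sup>2 - (\<Sum>t\<in>verts G. \<Sum>v\<in>verts G. if v = t then 0 else ?q (?C v t) t)"
    by (simp add: sum_subtractf power2_eq_square)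
  also have "(\<Sum>t\<in>verts G. \<Sum>v\<in>verts G. if v = t then 0 else ?q (?C v t) t) =
      (\<Sum>v\<in>verts G. \<Sum>t\<in>verts G. if v = t then 0 else ?q (?C v t) t)"
    by (rule sum.swap)
  also have "\<dots> = (\<Sum>v\<in>verts G. \<Sum>T\<in>pre_digraph.sccs (del_vert v).
      real (card (verts T)) * first_player_win_prob T)"
    by (rule sum.cong) (simp_all add: inner)
  finally show ?thesis
    using n assms(2) by (simp add: divide_simps) (simp add: algebra_simps)
qed

end

theory Submission
  imports Defs
begin

text \<open>
  One guess on a star leaves one of two kinds of position. Guessing the centre isolates every
  remaining leaf, and a one-vertex game is won at once by the player to move. Guessing a leaf
  leaves a star with one leaf fewer, which is still connected. Writing \<open>P n\<close> for the winning
  probability on the star with \<open>n\<close> vertices, the recursion for random play therefore reads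
  \<open>n\<^sup>2 P n = n\<^sup>2 - (n - 1) - (n - 1)\<^sup>2 P (n - 1)\<close>,
  and \<open>n\<^sup>2 P n = (n\<^sup>2 + 1\<^bsub>n odd\<^esub>) / 2\<close> solves it: the alternating sign of the recursion is what
  makes the parity of \<open>n\<close> appear.

  Deleting a vertex from a star on \<open>0, \<dots>, n - 1\<close> leaves gaps in the numbering, so the induction
  is carried out for stars with an arbitrary centre and an arbitrary finite set of leaves
  (\<open>first_player_win_prob_star\<close>). Components are handled through the vertices that they contain:
  summing \<open>|T| P T\<close> over the components \<open>T\<close> is the same as summing, over all vertices \<open>t\<close>, the
  value of the component of \<open>t\<close> (\<open>first_player_win_prob_rec_targets\<close>), so that it suffices to
  determine the component of each single vertex.
\<close>

text \<open>
  The factor \<open>|T|\<close> in the recursion counts the targets inside \<open>T\<close>; distributing it over them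
  removes any need to describe the set of all components.
\<close>

lemma first_player_win_prob_rec_targets:
  assumes "graph G" and "verts G \<noteq> {}"
  shows "(real (card (verts G)))\<^sup>2 * first_player_win_prob G =
    (real (card (verts G)))\<^sup>2 - (\<Sum>v\<in>verts G. \<Sum>t\<in>verts G - {v}.
       first_player_win_prob (component_of (pre_digraph.del_vert G v) t))"
proof -
  interpret graph G by fact
  have "(\<Sum>T\<in>pre_digraph.sccs (del_vert v). real (card (verts T)) * first_player_win_prob T) =
      (\<Sum>t\<in>verts G - {v}. first_player_win_prob (component_of (del_vert v) t))" for v
    using sum_over_sccs[OF fin_digraph_del_vert, of "\<lambda>T t. first_player_win_prob T" v]
    by (simp add: verts_del_vert)
  then show ?thesis
    using first_player_win_prob_rec[OF assms] assms(2)
    by (simp add: field_simps)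
qed

lemma first_player_win_prob_single_vertex:
  assumes "verts G = {x}"
  shows "first_player_win_prob G = 1"
  using first_player_win_prob_eq_sum[of G] pmf_random_play[of G x] assms by simp

lemma component_of_strongly_connected:
  assumes "wf_digraph G" and "strongly_connected G" and "t \<in> verts G"
  shows "component_of G t = G"
proof -
  interpret wf_digraph G by fact
  have "scc_of t = verts G"
  proof (rule set_eqI)
    fix v
    have "t \<rightarrow>\<^sup>*\<^bsub>G\<^esub> v \<and> v \<rightarrow>\<^sup>*\<^bsub>G\<^esub> t" if "v \<in> verts G"
      using assms(2,3) that unfolding strongly_connected_def by simp
    then show "v \<in> scc_of t \<longleftrightarrow> v \<in> verts G"
      unfolding scc_of_def mem_Collect_eq using reachable_in_verts(2)[of t v] by metis
  qed
  moreover have "{e \<in> arcs G. tail G e \<in> verts G \<and> head G e \<in> verts G} = arcs G"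
    by auto
  ultimately show ?thesis
    by (simp add: component_of_def induce_subgraph_def)
qed

lemma verts_component_of_no_arcs:
  assumes "arcs G = {}" and "t \<in> verts G"
  shows "verts (component_of G t) = {t}"
proof -
  have "u = v" if "u \<rightarrow>\<^sup>*\<^bsub>G\<^esub> v" for u v
    using that assms(1) unfolding reachable_def
    by (induction rule: rtrancl_on_induct) (auto simp: arcs_ends_def)
  then show ?thesis
    using assms(2) by (auto simp: component_of_def pre_digraph.scc_of_def reachable_def)
qed

definition star :: "'a \<Rightarrow> 'a set \<Rightarrow> ('a, 'a \<times> 'a) pre_digraph" where
  "star c L = with_proj \<lparr> pverts = insert c L, parcs = (\<Union>i\<in>L. {(c, i), (i, c)}) \<rparr>"

lemma star_graph_eq_star:
  assumes "n > 0"
  shows "star_graph n = star 0 {1..<n}"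
proof -
  have "{0..<n} = insert 0 {1..<n}"
    using assms by auto
  then show ?thesis
    by (simp add: star_graph_def star_def)
qed

lemma star_simps [simp]:
  "verts (star c L) = insert c L"
  "arcs (star c L) = (\<Union>i\<in>L. {(c, i), (i, c)})"
  "tail (star c L) = fst"
  "head (star c L) = snd"
  by (simp_all add: star_def with_proj_def)

lemma arcs_ends_star: "arcs_ends (star c L) = (\<Union>i\<in>L. {(c, i), (i, c)})"
  by (simp add: arcs_ends_def arc_to_ends_def)

lemma graph_star:
  assumes "finite L" and "c \<notin> L"
  shows "graph (star c L)"
proof -
  have "finite (arcs (star c L))"
    using assms(1) by simp
  then show ?thesis
    using assms
    by unfold_locales
      (auto simp: arc_to_ends_def symmetric_def arcs_ends_star sym_def)
qed

lemma strongly_connected_star: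
  assumes "finite L" and "c \<notin> L"
  shows "strongly_connected (star c L)"
proof -
  interpret graph "star c L"
    using assms by (rule graph_star)
  have "c \<rightarrow>\<^sup>*\<^bsub>star c L\<^esub> v \<and> v \<rightarrow>\<^sup>*\<^bsub>star c L\<^esub> c" if "v \<in> insert c L" for v
  proof (cases "v = c")
    case False
    then show ?thesis
      using that by (auto simp: arcs_ends_star)
  qed simp
  then show ?thesis
    by (intro strongly_connectedI) (simp, metis star_simps(1) reachable_trans)
qed

lemma del_leaf_star:
  assumes "c \<notin> L" and "v \<in> L"
  shows "pre_digraph.del_vert (star c L) v = star c (L - {v})"
  using assms by (intro pre_digraph.equality) (auto simp: pre_digraph.del_vert_simps)

lemma first_player_win_prob_star_rec:
  assumes "finite L" and "c \<notin> L"
  shows "(real (Suc (card L)))\<^sup>2 * first_player_win_prob (star c L) =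
    (real (Suc (card L)))\<^sup>2 - real (card L)
      - (\<Sum>v\<in>L. real (card L) * first_player_win_prob (star c (L - {v})))"
proof -
  let ?P = first_player_win_prob
  let ?C = "\<lambda>v t. component_of (pre_digraph.del_vert (star c L) v) t"
  have centre: "?P (?C c t) = 1" if "t \<in> L" for t
    using assms(2) that
    by (intro first_player_win_prob_single_vertex[of _ t] verts_component_of_no_arcs)
      (auto simp: pre_digraph.del_vert_simps)
  have leaf: "?P (?C v t) = ?P (star c (L - {v}))" if "v \<in> L" "t \<in> insert c (L - {v})" for v t
  proof -
    interpret graph "star c (L - {v})"
      using assms by (intro graph_star) auto
    have "?C v t = star c (L - {v})"
      unfolding del_leaf_star[OF assms(2) that(1)]
      using assms that by (intro component_of_strongly_connected strongly_connected_star)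
        (auto intro: wf_digraph_axioms)
    then show ?thesis by simp
  qed
  have sum_centre: "(\<Sum>t\<in>insert c L - {c}. ?P (?C c t)) = real (card L)"
    using assms(2) centre by simp
  have sum_leaf: "(\<Sum>t\<in>insert c L - {v}. ?P (?C v t)) =
      real (card L) * ?P (star c (L - {v}))" if v: "v \<in> L" for v
  proof -
    have V: "insert c L - {v} = insert c (L - {v})"
      using assms(2) v by auto
    have "card (insert c (L - {v})) = card L"
      using assms v card_gt_0_iff[of L] by auto
    \<comment> \<open>The summand is constant on all remaining vertices, so the centre must not be split off.\<close>
    then show ?thesis
      using leaf[OF v] by (simp add: V del: card_insert_disjoint sum.insert)
  qed
  have "(\<Sum>v\<in>insert c L. \<Sum>t\<in>insert c L - {v}. ?P (?C v t)) =
      real (card L) + (\<Sum>v\<in>L. real (card L) * ?P (star c (L - {v})))"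
    unfolding sum.insert[OF assms]
    by (intro arg_cong2[where f = "(+)"] sum.cong refl sum_centre sum_leaf)
  moreover have "card (verts (star c L)) = Suc (card L)" and "verts (star c L) \<noteq> {}"
    using assms by simp_all
  ultimately show ?thesis
    using first_player_win_prob_rec_targets[OF graph_star[OF assms]]
    by (simp only: star_simps simp_thms True_implies_equals diff_diff_eq)
qed

text \<open>
  Multiplying by the squared number of vertices frees the recursion of division, and the closed
  form then follows by induction on the number of leaves: every leaf that may be guessed
  contributes the same amount, since the induction hypothesis depends on the leaves only through
  their number. An even number of leaves means an odd number of vertices.
\<close>

lemma first_player_win_prob_star:
  assumes "finite L" and "c \<notin> L"
  shows "(real (Suc (card L)))\<^sup>2 * first_player_win_prob (star c L) =
    ((real (Suc (card L)))\<^sup>2 + of_bool (even (card L))) / 2"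
  using assms
proof (induction "card L" arbitrary: L)
  case 0
  then show ?case
    using first_player_win_prob_single_vertex[of "star c {}" c] by simp
next
  case (Suc k)
  have IH: "(real (Suc k))\<^sup>2 * first_player_win_prob (star c (L - {v})) =
      ((real (Suc k))\<^sup>2 + of_bool (even k)) / 2" if "v \<in> L" for v
  proof -
    have "k = card (L - {v})"
      using Suc.hyps(2) that by simp
    then show ?thesis
      using Suc.hyps(1)[of "L - {v}"] Suc.prems by simp
  qed
  have "(\<Sum>v\<in>L. real (card L) * first_player_win_prob (star c (L - {v}))) =
      (\<Sum>v\<in>L. ((real (Suc k))\<^sup>2 + of_bool (even k)) / 2 / real (Suc k))"
    using IH Suc.hyps(2)
    by (intro sum.cong refl) (simp add: field_simps power2_eq_square del: of_nat_Suc)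
  also have "\<dots> = ((real (Suc k))\<^sup>2 + of_bool (even k)) / 2"
    using Suc.hyps(2)[symmetric] by (simp del: of_nat_Suc)
  finally have "(real (Suc (card L)))\<^sup>2 * first_player_win_prob (star c L) =
      (real (Suc (card L)))\<^sup>2 - real (card L) - ((real (Suc k))\<^sup>2 + of_bool (even k)) / 2"
    using first_player_win_prob_star_rec[OF Suc.prems] by simp
  also have "\<dots> = ((real (Suc (card L)))\<^sup>2 + of_bool (even (card L))) / 2"
    unfolding Suc.hyps(2)[symmetric]
    by (cases "even k") (simp_all add: power2_eq_square field_simps)
  finally show ?case .
qed

theorem theorem5p1:
  fixes n :: nat
  assumes "n > 0"
  shows "first_player_win_prob (star_graph n) =
           1 / 2 + 1 / (2 * (real n)\<^sup>2) * of_bool (odd n)"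
proof -
  have "Suc (card {1..<n}) = n" and "even (card {1..<n}) \<longleftrightarrow> odd n"
    using assms by auto
  then have "(real n)\<^sup>2 * first_player_win_prob (star_graph n) = ((real n)\<^sup>2 + of_bool (odd n)) / 2"
    using first_player_win_prob_star[of "{1..<n}" "0::nat"] star_graph_eq_star[OF assms] by simp
  then show ?thesis
    using assms by (simp add: field_simps)
qed

end
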